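(* Let $f_0,f_1\in\mathcal{S}_f$ and $g_0,g_1\in\mathcal{S}_g$ be non-decreasing profiles, and for $\lambda\in[0,1]$ let $f_\lambda$ be the displacement interpolant between $f_0$ and $f_1$, and $g_\lambda$ the displacement interpolant between $g_0$ and $g_1$. The potential $\mathcal{W}$ is displacement convex, which means that for all $\lambda\in[0,1]$ $$\mathcal{W}(f_\lambda,g_\lambda)\;\leq\;(1-\lambda)\,\mathcal{W}(f_0,g_0)+\lambda\,\mathcal{W}(f_1,g_1).$$
   Context: Window. $w:\mathbb{R}\to\mathbb{R}$ is bounded, non-negative, even, integrable, with $\int_{\mathbb{R}}w(x)\,dx=1$. For a profile $g$, $g^w=g\otimes w$ denotes convolution on $\mathbb{R}$: $g^w(x)=\int_{\mathbb{R}}w(x-y)g(y)\,dy$. Update functions. $h_f,h_g:[0,1]\to[0,1]$ are non-decreasing with $h_f(0)=h_g(0)=0$ and $h_f(1)=h_g(1)=1$. The inverses $h_f^{-1},h_g^{-1}$ are understood as (generalized) inverses of non-decreasing functions, e.g. $h^{-1}(u)=\sup\{v\in[0,1]: h(v)\le u\}$; they only appear inside integrals, where the choice of generalized inverse is immaterial. With $A(h_f,h_g;u)=\int_0^u\big(h_g^{-1}(u')-h_f(u')\big)\,du'$, it is assumed throughout (strictly positive gap condition) that $A(h_f,h_g;u)>0$ for all $u\in\,]0,1[$ and $A(h_f,h_g;1)=0$. Profile spaces. Fix $\epsilon>0$. $\mathcal{S}_f=\mathcal{S}_g$ is the set of measurable functions $p:\mathbb{R}\to[0,1]$ with $\lim_{x\to-\infty}|x|^{1+\epsilon}p(x)=0$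 and $\lim_{x\to+\infty}x^{1+\epsilon}(p(x)-1)=0$. Non-decreasing profiles are viewed as cumulative distribution functions of probability measures on $\mathbb{R}$. Potential. For $f\in\mathcal{S}_f$, $g\in\mathcal{S}_g$, $$\mathcal{W}(f,g)=\int_{\mathbb{R}}dx\Big\{\int_0^{g(x)}h_g^{-1}(u)\,du+\int_0^{f(x)}h_f^{-1}(v)\,dv-f(x)\,g^w(x)\Big\},$$ which is a well-defined element of $(-\infty,+\infty]$ (finite if $w$ decays fast enough); the convention $0\cdot(+\infty)=0$ is used. Displacement interpolation. For non-decreasing profiles $p_0,p_1$ put $T_p(x)=p_1^{-1}(p_0(x))$ and $x_{p,\lambda}=(1-\lambda)x+\lambda T_p(x)$. The displacement interpolant $p_\lambda$ is defined by $p_\lambda(x_{p,\lambda})=p_0(x)$ for all $x\in\mathbb{R}$ and $\lambda\in[0,1]$. For general non-decreasing profiles (possibly with jumps or flat parts) this is understood in terms of generalized inverses (quantile functions) $p^{-1}(u)=\inf\{x: p(x)\ge u\}$, $u\in\,]0,1[$: $p_\lambda$ is the cumulative distribution function whose quantile function is $p_\lambda^{-1}(u)=(1-\lambda)p_0^{-1}(u)+\lambda p_1^{-1}(u)$. *)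

theory Defs
  imports "HOL-Probability.Probability"
begin

definition window :: "(real \<Rightarrow> real) \<Rightarrow> bool" where
  "window w \<longleftrightarrow>
     bounded (range w) \<and> (\<forall>x. 0 \<le> w x) \<and> (\<forall>x. w (- x) = w x) \<and>
     integrable lebesgue w \<and> (LINT x|lebesgue. w x) = 1"

definition smoothed :: "(real \<Rightarrow> real) \<Rightarrow> (real \<Rightarrow> real) \<Rightarrow> real \<Rightarrow> real" where
  "smoothed w g x = (LINT y|lebesgue. w (x - y) * g y)"

text \<open>Update functions are total functions on the reals; only their values on the unit
  interval are constrained and used.\<close>

definition update_function :: "(real \<Rightarrow> real) \<Rightarrow> bool" where
  "update_function h \<longleftrightarrow>
     h \<in> {0..1} \<rightarrow> {0..1} \<and> mono_on {0..1} h \<and> h 0 = 0 \<and> h 1 = 1"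

definition gen_inverse :: "(real \<Rightarrow> real) \<Rightarrow> real \<Rightarrow> real" where
  "gen_inverse h u = Sup {v \<in> {0..1}. h v \<le> u}"

definition gap :: "(real \<Rightarrow> real) \<Rightarrow> (real \<Rightarrow> real) \<Rightarrow> real \<Rightarrow> real" where
  "gap hf hg u = (LINT u':{0..u}|lebesgue. gen_inverse hg u' - hf u')"

definition strictly_positive_gap :: "(real \<Rightarrow> real) \<Rightarrow> (real \<Rightarrow> real) \<Rightarrow> bool" where
  "strictly_positive_gap hf hg \<longleftrightarrow> (\<forall>u\<in>{0<..<1}. gap hf hg u > 0) \<and> gap hf hg 1 = 0"

definition profiles :: "real \<Rightarrow> (real \<Rightarrow> real) set" where
  "profiles \<epsilon> = {p. p \<in> borel_measurable lebesgue \<and> range p \<subseteq> {0..1} \<and>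
     ((\<lambda>x. \<bar>x\<bar> powr (1 + \<epsilon>) * p x) \<longlongrightarrow> 0) at_bot \<and>
     ((\<lambda>x. x powr (1 + \<epsilon>) * (p x - 1)) \<longlongrightarrow> 0) at_top}"

text \<open>Lebesgue integral with values in the extended reals, as positive part minus negative
  part. On \<^typ>\<open>ereal\<close> one has \<open>\<infinity> - \<infinity> = \<infinity>\<close>, but this case does not occur for
  \<open>potential\<close> below: under the gap condition its integrand is bounded below by
  \<open>f x * (g x - smoothed w g x)\<close>, whose negative part is integrable for profiles.\<close>

definition extended_integral :: "(real \<Rightarrow> real) \<Rightarrow> ereal" where
  "extended_integral F =
     enn2ereal (\<integral>\<^sup>+ x. ennreal (F x) \<partial>lebesgue) - enn2ereal (\<integral>\<^sup>+ x. ennreal (- F x) \<partial>lebesgue)"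

definition potential ::
  "(real \<Rightarrow> real) \<Rightarrow> (real \<Rightarrow> real) \<Rightarrow> (real \<Rightarrow> real) \<Rightarrow> (real \<Rightarrow> real) \<Rightarrow> (real \<Rightarrow> real) \<Rightarrow> ereal" where
  "potential w hf hg f g = extended_integral (\<lambda>x.
     (LINT u:{0..g x}|lebesgue. gen_inverse hg u)
     + (LINT v:{0..f x}|lebesgue. gen_inverse hf v)
     - f x * smoothed w g x)"

definition quantile :: "(real \<Rightarrow> real) \<Rightarrow> real \<Rightarrow> real" where
  "quantile p u = Inf {x. u \<le> p x}"

definition is_displacement_interpolant ::
  "(real \<Rightarrow> real) \<Rightarrow> (real \<Rightarrow> real) \<Rightarrow> real \<Rightarrow> (real \<Rightarrow> real) \<Rightarrow> bool" where
  "is_displacement_interpolant p0 p1 t p \<longleftrightarrow>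
     (\<exists>M. real_distribution M \<and> p = cdf M) \<and>
     (\<forall>u\<in>{0<..<1}. quantile p u = (1 - t) * quantile p0 u + t * quantile p1 u)"

definition displacement_interpolant ::
  "(real \<Rightarrow> real) \<Rightarrow> (real \<Rightarrow> real) \<Rightarrow> real \<Rightarrow> real \<Rightarrow> real" where
  "displacement_interpolant p0 p1 t = (THE p. is_displacement_interpolant p0 p1 t p)"


subsection \<open>The displacement interpolant is well defined\<close>

lemma profiles_limits:
  assumes p: "p \<in> profiles \<epsilon>" and eps: "\<epsilon> > 0"
  shows "(p \<longlongrightarrow> 0) at_bot" "(p \<longlongrightarrow> 1) at_top"
proof -
  have r: "0 \<le> p x" "p x \<le> 1" for x
    using p by (auto simp: profiles_def image_subset_iff)
  have l1: "((\<lambda>x. \<bar>x\<bar> powr (1 + \<epsilon>) * p x) \<longlongrightarrow> 0) at_bot"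
    and l2: "((\<lambda>x. x powr (1 + \<epsilon>) * (p x - 1)) \<longlongrightarrow> 0) at_top"
    using p by (auto simp: profiles_def)
  show "(p \<longlongrightarrow> 0) at_bot"
  proof (rule tendsto_sandwich[OF _ _ tendsto_const l1])
    show "\<forall>\<^sub>F x in at_bot. 0 \<le> p x" by (simp add: r)
    show "\<forall>\<^sub>F x in at_bot. p x \<le> \<bar>x\<bar> powr (1 + \<epsilon>) * p x"
      using eventually_le_at_bot[of "-1::real"]
    proof eventually_elim
      case (elim x)
      then have "1 \<le> \<bar>x\<bar> powr (1 + \<epsilon>)" using eps by (intro ge_one_powr_ge_zero) auto
      then show ?case using r(1)[of x] by (simp add: mult_le_cancel_right1)
    qed
  qed
  have "((\<lambda>x. p x - 1) \<longlongrightarrow> 0) at_top"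
  proof (rule tendsto_sandwich[OF _ _ l2 tendsto_const])
    show "\<forall>\<^sub>F x in at_top. p x - 1 \<le> 0" by (simp add: r)
    show "\<forall>\<^sub>F x in at_top. x powr (1 + \<epsilon>) * (p x - 1) \<le> p x - 1"
      using eventually_ge_at_top[of "1::real"]
    proof eventually_elim
      case (elim x)
      then have "1 \<le> x powr (1 + \<epsilon>)" using eps by (intro ge_one_powr_ge_zero) auto
      then have "1 * (1 - p x) \<le> x powr (1 + \<epsilon>) * (1 - p x)"
        using r(2)[of x] by (intro mult_right_mono) auto
      then show ?case by (simp add: algebra_simps)
    qed
  qed
  from tendsto_add[OF this tendsto_const[of 1]] show "(p \<longlongrightarrow> 1) at_top" by simp
qed

lemma quantile_set:
  fixes p :: "real \<Rightarrow> real"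
  assumes "mono p" "(p \<longlongrightarrow> 0) at_bot" "(p \<longlongrightarrow> 1) at_top" and u: "u \<in> {0<..<1::real}"
  shows "{x. u \<le> p x} \<noteq> {}" "bdd_below {x. u \<le> p x}"
proof -
  have "\<forall>\<^sub>F x in at_top. u < p x" using assms by (intro order_tendstoD(1)[of p 1]) auto
  from eventually_happens'[OF trivial_limit_at_top_linorder this] obtain x where "u < p x" ..
  then show "{x. u \<le> p x} \<noteq> {}" by (auto intro: less_imp_le)
  have "\<forall>\<^sub>F x in at_bot. p x < u" using assms by (intro order_tendstoD(2)[of p 0]) auto
  from eventually_happens'[OF trivial_limit_at_bot_linorder this] obtain y where "p y < u" ..
  then have "y \<le> x" if "u \<le> p x" for x
    using that monoD[OF \<open>mono p\<close>, of x y] by linarith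
  then show "bdd_below {x. u \<le> p x}" by (auto intro!: bdd_belowI)
qed

lemma quantile_mono:
  assumes "mono p" "(p \<longlongrightarrow> 0) at_bot" "(p \<longlongrightarrow> 1) at_top"
    and "u \<in> {0<..<1}" "v \<in> {0<..<1}" "u \<le> v"
  shows "quantile p u \<le> quantile p v"
  unfolding quantile_def
  by (rule cInf_superset_mono) (use assms quantile_set[OF assms(1-3)] in auto)

lemma quantile_left_cont:
  assumes p: "mono p" "(p \<longlongrightarrow> 0) at_bot" "(p \<longlongrightarrow> 1) at_top"
    and u: "u \<in> {0<..<1}" and e: "e > 0"
  shows "\<exists>v\<in>{0<..<u}. \<forall>v'\<in>{v..u}. quantile p v' > quantile p u - e"
proof -
  define x where "x = quantile p u - e / 2"
  have "p x < u"
  proof (rule ccontr)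
    assume "\<not> p x < u"
    then have "quantile p u \<le> x" unfolding quantile_def
      using quantile_set[OF p u] by (intro cInf_lower) auto
    then show False using e by (simp add: x_def)
  qed
  define v where "v = (max 0 (p x) + u) / 2"
  have v: "0 < v" "v < u" "p x < v" using \<open>p x < u\<close> u by (auto simp: v_def)
  have "quantile p v' > quantile p u - e" if "v' \<in> {v..u}" for v'
  proof -
    have v': "v' \<in> {0<..<1}" using that v u by auto
    have "x \<le> quantile p v'" unfolding quantile_def
    proof (rule cInf_greatest)
      show "{x. v' \<le> p x} \<noteq> {}" by (rule quantile_set[OF p v'])
      fix y assume "y \<in> {x. v' \<le> p x}"
      then have "p x < p y" using that v by auto
      then show "x \<le> y" using monoD[OF p(1), of y x] by linarith
    qed
    then show ?thesis using e by (simp add: x_def)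
  qed
  then show ?thesis using v by (intro bexI[of _ v]) auto
qed

lemma cdf_quantile_le_iff:
  assumes M: "real_distribution M" and u: "u \<in> {0<..<1}"
  shows "u \<le> cdf M x \<longleftrightarrow> quantile (cdf M) u \<le> x"
proof -
  interpret cdf_distribution M using M by (simp add: cdf_distribution_def)
  show ?thesis using pseudoinverse[of u x] u by (simp add: quantile_def)
qed

lemma is_displacement_interpolant_unique:
  assumes p: "is_displacement_interpolant p0 p1 t p"
    and q: "is_displacement_interpolant p0 p1 t q"
  shows "p = q"
proof -
  obtain M N where M: "real_distribution M" "p = cdf M" and N: "real_distribution N" "q = cdf N"
    using p q by (auto simp: is_displacement_interpolant_def)
  interpret M: real_distribution M by fact
  interpret N: real_distribution N by fact
  have iff: "u \<le> p x \<longleftrightarrow> u \<le> q x" if "u \<in> {0<..<1}" for u x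
    using cdf_quantile_le_iff[OF M(1) that, of x] cdf_quantile_le_iff[OF N(1) that, of x] p q that
    by (simp add: M(2) N(2) is_displacement_interpolant_def)
  have b: "0 \<le> p x" "p x \<le> 1" "0 \<le> q x" "q x \<le> 1" for x
    by (auto simp: M(2) N(2) M.cdf_nonneg N.cdf_nonneg M.cdf_bounded_prob N.cdf_bounded_prob)
  show ?thesis
  proof
    fix x
    show "p x = q x"
    proof (rule ccontr)
      assume "p x \<noteq> q x"
      define u where "u = (p x + q x) / 2"
      have "u \<in> {0<..<1}" using b[of x] \<open>p x \<noteq> q x\<close> by (auto simp: u_def)
      from iff[OF this, of x] \<open>p x \<noteq> q x\<close> show False
        by (auto simp: u_def field_simps)
    qed
  qed
qed

lemma is_displacement_interpolant_exists:
  assumes p0: "mono p0" "(p0 \<longlongrightarrow> 0) at_bot" "(p0 \<longlongrightarrow> 1) at_top"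
    and p1: "mono p1" "(p1 \<longlongrightarrow> 0) at_bot" "(p1 \<longlongrightarrow> 1) at_top"
    and lam: "t \<in> {0..1}"
  shows "\<exists>p. is_displacement_interpolant p0 p1 t p"
proof -
  define q where "q u = (1 - t) * quantile p0 u + t * quantile p1 u" for u
  have q_mono: "q u \<le> q v" if "u \<in> {0<..<1}" "v \<in> {0<..<1}" "u \<le> v" for u v
    unfolding q_def using lam quantile_mono[OF p0 that] quantile_mono[OF p1 that]
    by (intro add_mono mult_left_mono) auto
  have q_left: "\<exists>v\<in>{0<..<u}. q v > x" if u: "u \<in> {0<..<1}" and x: "x < q u" for u x
  proof -
    have e: "q u - x > 0" using x by simp
    obtain v0 where v0: "v0 \<in> {0<..<u}"
      "\<forall>v'\<in>{v0..u}. quantile p0 v' > quantile p0 u - (q u - x)"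
      using quantile_left_cont[OF p0 u e] by blast
    obtain v1 where v1: "v1 \<in> {0<..<u}"
      "\<forall>v'\<in>{v1..u}. quantile p1 v' > quantile p1 u - (q u - x)"
      using quantile_left_cont[OF p1 u e] by blast
    define v where "v = max v0 v1"
    have v: "v \<in> {0<..<u}" "v \<in> {v0..u}" "v \<in> {v1..u}" using v0(1) v1(1) by (auto simp: v_def)
    define a where "a = quantile p0 v - (quantile p0 u - (q u - x))"
    define b where "b = quantile p1 v - (quantile p1 u - (q u - x))"
    have ab: "a > 0" "b > 0" using v0(2) v1(2) v by (auto simp: a_def b_def)
    have "q v - x = (1 - t) * a + t * b"
      by (simp add: a_def b_def q_def algebra_simps)
    moreover have "(1 - t) * a + t * b > 0"
    proof (cases "t = 0")
      case True
      then show ?thesis using ab by simp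
    next
      case False
      then show ?thesis using ab lam by (intro add_nonneg_pos) auto
    qed
    ultimately show ?thesis using v by (intro bexI[of _ v]) auto
  qed
  let ?\<Omega> = "restrict_space lborel {0<..<1::real}"
  interpret \<Omega>: prob_space ?\<Omega>
    by (auto simp: space_restrict_space emeasure_restrict_space intro!: prob_spaceI)
  have "q \<in> borel_measurable (restrict_space borel {0<..<1})"
    by (intro borel_measurable_mono_on_fnc mono_onI q_mono)
  then have q_meas [measurable]: "q \<in> borel_measurable ?\<Omega>"
    using measurable_cong_sets[OF sets_restrict_space_cong[OF sets_lborel] refl] by blast
  define M where "M = distr ?\<Omega> borel q"
  have M: "real_distribution M"
    unfolding M_def by (intro \<Omega>.real_distribution_distr q_meas)
  have cdfM: "cdf M x = \<Omega>.prob {v \<in> {0<..<1}. q v \<le> x}" for x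
    unfolding M_def cdf_def
    by (subst measure_distr) (auto simp: space_restrict_space intro!: arg_cong[where f="measure _"])
  have sets: "{v \<in> {0<..<1}. q v \<le> x} \<in> sets ?\<Omega>" for x
  proof -
    have "{v \<in> space ?\<Omega>. q v \<le> x} \<in> sets ?\<Omega>" by measurable
    then show ?thesis by (simp add: space_restrict_space)
  qed
  have prob_Ioc: "\<Omega>.prob {0<..u} = u" "{0<..u} \<in> sets ?\<Omega>" if "u \<in> {0<..<1}" for u :: real
  proof -
    have sub: "{0<..u} \<subseteq> {0<..<1}" using that by auto
    then show "\<Omega>.prob {0<..u} = u" using that by (subst measure_restrict_space) auto
    show "{0<..u} \<in> sets ?\<Omega>" using sub by (subst sets_restrict_space_iff) auto
  qed
  have iff: "u \<le> cdf M x \<longleftrightarrow> q u \<le> x" if u: "u \<in> {0<..<1}" for u x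
  proof
    assume "q u \<le> x"
    then have "{0<..u} \<subseteq> {v \<in> {0<..<1}. q v \<le> x}"
      using u q_mono[OF _ u] by force
    from \<Omega>.finite_measure_mono[OF this sets] show "u \<le> cdf M x"
      by (simp add: cdfM prob_Ioc[OF u])
  next
    assume le: "u \<le> cdf M x"
    show "q u \<le> x"
    proof (rule ccontr)
      assume "\<not> q u \<le> x"
      then obtain v where v: "v \<in> {0<..<u}" "q v > x" using q_left[OF u, of x] by auto
      have v01: "v \<in> {0<..<1}" using v u by auto
      have "{v \<in> {0<..<1}. q v \<le> x} \<subseteq> {0<..v}"
        using q_mono[OF v01] v by force
      from \<Omega>.finite_measure_mono[OF this prob_Ioc(2)[OF v01]] have "cdf M x \<le> v"
        by (simp add: cdfM prob_Ioc[OF v01])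
      then show False using le v by auto
    qed
  qed
  have "quantile (cdf M) u = q u" if "u \<in> {0<..<1}" for u
  proof -
    have "{x. u \<le> cdf M x} = {q u..}" using iff[OF that] by auto
    then show ?thesis by (simp add: quantile_def)
  qed
  then have "is_displacement_interpolant p0 p1 t (cdf M)"
    unfolding is_displacement_interpolant_def q_def using M by auto
  then show ?thesis by (intro exI[of _ "cdf M"])
qed

lemma is_displacement_interpolant_displacement_interpolant:
  assumes "\<epsilon> > 0" "p0 \<in> profiles \<epsilon>" "mono p0" "p1 \<in> profiles \<epsilon>" "mono p1" "t \<in> {0..1}"
  shows "is_displacement_interpolant p0 p1 t (displacement_interpolant p0 p1 t)"
proof -
  have "\<exists>p. is_displacement_interpolant p0 p1 t p"
    using assms by (intro is_displacement_interpolant_exists profiles_limits)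
  then have "\<exists>!p. is_displacement_interpolant p0 p1 t p"
    using is_displacement_interpolant_unique by blast
  then show ?thesis unfolding displacement_interpolant_def by (rule theI')
qed

end

theory Submission
  imports Defs
begin

text \<open>
  Let \<open>a = gen_inverse hf\<close> and \<open>b = gen_inverse hg\<close>, and let \<open>q\<close> and \<open>r\<close> be the quantile
  functions of \<open>f\<close> and \<open>g\<close>. Writing \<open>H\<close> for the Heaviside step, \<open>A(s)\<close>, \<open>B(s)\<close> for the integrals
  of \<open>a\<close>, \<open>b\<close> over \<open>[0, s]\<close>, and using \<open>A(1) + B(1) = 1\<close> (which is \<open>gap hf hg 1 = 0\<close>), the
  integrand of the potential is
  \<open>(A(f) - A(1) H) + (B(g) - B(1) H) - (f - H) + f (1 - smoothed w g)\<close>.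
  By the layer-cake formula the first three terms integrate to
  \<open>- \<integral> a q - \<integral> b r + \<integral> q\<close>, which is linear in the quantile functions. The last term is
  nonnegative and, by Tonelli, integrates to the triple integral of
  \<open>w(z) max 0 (r(v) + z - q(u))\<close> over \<open>u, v \<in> (0, 1)\<close> and real \<open>z\<close>, which is convex in \<open>(q, r)\<close>.
  Displacement interpolation is linear interpolation of quantile functions.
\<close>

section \<open>Lebesgue measure on the open unit interval\<close>

text \<open>The interval is open because at the levels 0 and 1 the set
  \<open>{x. u \<le> p x}\<close> behind the quantile may be unbounded below or empty.\<close>

definition unif :: "real measure" where
  "unif = restrict_space lborel {0<..<1}"

lemma prob_space_unif: "prob_space unif"
  by (auto simp: unif_def space_restrict_space emeasure_restrict_space intro!: prob_spaceI)

interpretation unif: prob_space unif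
  by (rule prob_space_unif)

interpretation unif_lborel: pair_sigma_finite unif lborel ..

lemma space_unif [simp]: "space unif = {0<..<1}"
  by (simp add: unif_def space_restrict_space)

lemma measurable_unif_ident: "(\<lambda>u. u) \<in> borel_measurable unif"
  unfolding unif_def by (rule measurable_restrict_space1) simp

text \<open>Serves the Tonelli steps below, whose integrands contain rays with an endpoint depending
  on the other variable. Writing the indicator as an if-then-else turns such a moving set into an
  order predicate.\<close>

lemma measurable_indicator_ray_unif [measurable (raw)]:
  fixes f g :: "'a \<Rightarrow> real"
  assumes "f \<in> N \<rightarrow>\<^sub>M unif" and [measurable]: "g \<in> borel_measurable N"
  shows "(\<lambda>x. indicator {..g x} (f x) :: ennreal) \<in> borel_measurable N"
    and "(\<lambda>x. indicator {g x..} (f x) :: ennreal) \<in> borel_measurable N"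
    and "(\<lambda>x. indicator {g x<..} (f x) :: ennreal) \<in> borel_measurable N"
proof -
  have [measurable]: "f \<in> borel_measurable N"
    using measurable_compose[OF assms(1) measurable_unif_ident] by simp
  have "(\<lambda>x. if f x \<le> g x then 1 else 0 :: ennreal) \<in> borel_measurable N"
    "(\<lambda>x. if g x < f x then 1 else 0 :: ennreal) \<in> borel_measurable N"
    by measurable
  moreover have "(\<lambda>x. if g x \<le> f x then 1 else 0 :: ennreal) \<in> borel_measurable N"
    by measurable
  ultimately show "(\<lambda>x. indicator {..g x} (f x) :: ennreal) \<in> borel_measurable N"
    and "(\<lambda>x. indicator {g x..} (f x) :: ennreal) \<in> borel_measurable N"
    and "(\<lambda>x. indicator {g x<..} (f x) :: ennreal) \<in> borel_measurable N"
    by (simp_all add: indicator_def of_bool_def)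
qed

lemma mono_on_measurable_unif:
  fixes q :: "real \<Rightarrow> real"
  assumes "mono_on {0<..<1} q"
  shows "q \<in> borel_measurable unif"
  using borel_measurable_mono_on_fnc[OF assms] unfolding unif_def
  using measurable_cong_sets[OF sets_restrict_space_cong[OF sets_lborel] refl] by blast

lemma emeasure_unif_Iic:
  assumes "s \<in> {0..1}"
  shows "emeasure unif ({0<..<1} \<inter> {..s}) = ennreal s"
proof -
  have "emeasure unif ({0<..<1} \<inter> {..s}) = emeasure lborel ({0<..<1} \<inter> {..s})"
    by (simp add: unif_def emeasure_restrict_space)
  also have "\<dots> = emeasure lborel {0<..s}"
  proof (rule emeasure_eq_AE)
    \<comment> \<open>For \<open>s = 1\<close> the two sets differ in the point 1.\<close>
    show "AE x in lborel. x \<in> {0<..<1} \<inter> {..s} \<longleftrightarrow> x \<in> {0<..s}"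
      using AE_lborel_singleton[of 1] by eventually_elim (use assms in auto)
  qed auto
  also have "\<dots> = ennreal s" using assms by simp
  finally show ?thesis .
qed

text \<open>The elementary layer cake: with \<open>s = p x\<close> it trades the value of a
  distribution function for an integral over levels \<open>u\<close>, which Tonelli can then move
  outside.\<close>

lemma nn_integral_unif_le:
  assumes "s \<in> {0..1}"
  shows "(\<integral>\<^sup>+u. indicator {..s} u \<partial>unif) = ennreal s"
proof -
  have "(\<integral>\<^sup>+u. indicator {..s} u \<partial>unif) = (\<integral>\<^sup>+u. indicator ({0<..<1} \<inter> {..s}) u \<partial>unif)"
    by (intro nn_integral_cong) (auto simp: indicator_def)
  also have "\<dots> = emeasure unif ({0<..<1} \<inter> {..s})"
    by (rule nn_integral_indicator) (auto simp: unif_def sets_restrict_space)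
  finally show ?thesis using emeasure_unif_Iic[OF assms] by simp
qed

lemma nn_integral_unif_gt:
  assumes "s \<in> {0..1}"
  shows "(\<integral>\<^sup>+u. indicator {s<..} u \<partial>unif) = ennreal (1 - s)"
proof -
  have "1 = (\<integral>\<^sup>+u. 1 \<partial>unif)" using unif.emeasure_space_1 by simp
  also have "\<dots> = (\<integral>\<^sup>+u. indicator {..s} u + indicator {s<..} u \<partial>unif)"
    by (intro nn_integral_cong) (auto simp: indicator_def)
  also have "\<dots> = ennreal s + (\<integral>\<^sup>+u. indicator {s<..} u \<partial>unif)"
    by (subst nn_integral_add) (auto simp: nn_integral_unif_le[OF assms])
  finally have "ennreal s + (\<integral>\<^sup>+u. indicator {s<..} u \<partial>unif) = ennreal s + ennreal (1 - s)"
    using assms by (simp flip: ennreal_plus)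
  then show ?thesis by simp
qed

lemma LINT_Icc_eq_unif:
  fixes a :: "real \<Rightarrow> real"
  assumes "mono_on {0..1} a" "s \<in> {0..1}"
  shows "(LINT u:{0..s}|lebesgue. a u) = (\<integral>u. indicator {..s} u * a u \<partial>unif)"
proof -
  have "a \<in> borel_measurable (restrict_space borel {0..1})"
    by (rule borel_measurable_mono_on_fnc) fact
  \<comment> \<open>Nothing is known about \<open>a\<close> outside the unit interval, hence the
    cut-off by the indicator.\<close>
  then have m [measurable]: "(\<lambda>u. indicator {0..1} u * a u) \<in> borel_measurable borel"
    by (subst (asm) borel_measurable_restrict_space_iff) auto
  have "(LINT u:{0..s}|lebesgue. a u) =
      (\<integral>u. indicator {0..s} u * (indicator {0..1} u * a u) \<partial>lebesgue)"
    unfolding set_lebesgue_integral_def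
    by (intro Bochner_Integration.integral_cong) (use assms in \<open>auto simp: indicator_def\<close>)
  also have "\<dots> = (\<integral>u. indicator {0..s} u * (indicator {0..1} u * a u) \<partial>lborel)"
    by (rule integral_completion) simp
  also have "\<dots> = (\<integral>u. indicator {0<..<1} u * (indicator {..s} u * (indicator {0..1} u * a u)) \<partial>lborel)"
  proof (rule integral_cong_AE)
    show "AE u in lborel. indicator {0..s} u * (indicator {0..1} u * a u) =
        indicator {0<..<1} u * (indicator {..s} u * (indicator {0..1} u * a u))"
      using AE_lborel_singleton[of 0] AE_lborel_singleton[of 1]
      by eventually_elim (use assms in \<open>auto simp: indicator_def\<close>)
  qed simp_all
  also have "\<dots> = (\<integral>u. indicator {..s} u * (indicator {0..1} u * a u) \<partial>unif)"
    unfolding unif_def by (subst integral_restrict_space) auto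
  also have "\<dots> = (\<integral>u. indicator {..s} u * a u \<partial>unif)"
    by (intro Bochner_Integration.integral_cong) (auto simp: indicator_def)
  finally show ?thesis .
qed

text \<open>The weight is bounded by \<open>a 1\<close>, hence integrable on a probability space.
  The masses below and above level \<open>s\<close> appear in \<open>ennreal\<close> form, ready for
  Tonelli.\<close>

lemma cumulative_weight:
  fixes a :: "real \<Rightarrow> real"
  assumes mono: "mono_on {0..1} a" and nonneg: "\<And>u. u \<in> {0..1} \<Longrightarrow> 0 \<le> a u" and s: "s \<in> {0..1}"
  defines "A \<equiv> \<lambda>s. LINT u:{0..s}|lebesgue. a u"
  shows "0 \<le> A s" "A s \<le> A 1"
    "ennreal (A s) = (\<integral>\<^sup>+u. ennreal (a u) * indicator {..s} u \<partial>unif)"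
    "ennreal (A 1 - A s) = (\<integral>\<^sup>+u. ennreal (a u) * indicator {s<..} u \<partial>unif)"
proof -
  have [measurable]: "a \<in> borel_measurable unif"
    by (intro mono_on_measurable_unif mono_on_subset[OF mono]) auto
  have le: "a u \<le> a 1" if "u \<in> {0..1}" for u
    using mono_onD[OF mono, of u 1] that by auto
  have int: "integrable unif (\<lambda>u. indicator S u * a u)" if [measurable]: "S \<in> sets borel" for S
  proof (rule unif.integrable_const_bound[where B = "a 1"])
    have [measurable]: "(\<lambda>u. indicator S u :: real) \<in> borel_measurable unif"
      using measurable_compose[OF measurable_unif_ident borel_measurable_indicator[OF that]] .
    show "(\<lambda>u. indicator S u * a u) \<in> borel_measurable unif" by measurable
  qed (auto simp: indicator_def nonneg le)
  have A: "A t = (\<integral>u. indicator {..t} u * a u \<partial>unif)" if "t \<in> {0..1}" for t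
    unfolding A_def by (rule LINT_Icc_eq_unif[OF mono that])
  have nn: "ennreal (\<integral>u. indicator S u * a u \<partial>unif) = (\<integral>\<^sup>+u. ennreal (a u) * indicator S u \<partial>unif)"
    if "S \<in> sets borel" for S
  proof -
    have "(\<integral>\<^sup>+u. ennreal (a u) * indicator S u \<partial>unif) = (\<integral>\<^sup>+u. ennreal (indicator S u * a u) \<partial>unif)"
      by (intro nn_integral_cong) (auto simp: indicator_def)
    also have "\<dots> = ennreal (\<integral>u. indicator S u * a u \<partial>unif)"
      by (rule nn_integral_eq_integral[OF int[OF that]]) (auto simp: indicator_def nonneg intro!: AE_I2)
    finally show ?thesis ..
  qed
  show "ennreal (A s) = (\<integral>\<^sup>+u. ennreal (a u) * indicator {..s} u \<partial>unif)"
    by (simp add: A[OF s] nn)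
  show "0 \<le> A s"
    unfolding A[OF s] by (rule Bochner_Integration.integral_nonneg) (auto simp: indicator_def nonneg)
  have diff: "A 1 - A s = (\<integral>u. indicator {s<..} u * a u \<partial>unif)"
    unfolding A[OF s] A[of 1, simplified]
    by (subst Bochner_Integration.integral_diff[symmetric, OF int int])
      (auto simp: indicator_def intro!: Bochner_Integration.integral_cong)
  show "ennreal (A 1 - A s) = (\<integral>\<^sup>+u. ennreal (a u) * indicator {s<..} u \<partial>unif)"
    unfolding diff by (rule nn) simp
  have "0 \<le> A 1 - A s" unfolding diff
    by (rule Bochner_Integration.integral_nonneg) (auto simp: indicator_def nonneg)
  then show "A s \<le> A 1" by simp
qed

section \<open>Distribution functions and their quantiles\<close>

text \<open>Right continuity is left out, so that the notion covers both the given monotone profiles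
  and the interpolants, which are values of \<open>cdf\<close>.\<close>

definition cdf_like :: "(real \<Rightarrow> real) \<Rightarrow> bool" where
  "cdf_like p \<longleftrightarrow> mono p \<and> (p \<longlongrightarrow> 0) at_bot \<and> (p \<longlongrightarrow> 1) at_top"

lemma cdf_like_bounds:
  assumes "cdf_like p"
  shows "p x \<in> {0..1}"
proof -
  have p: "mono p" "(p \<longlongrightarrow> 0) at_bot" "(p \<longlongrightarrow> 1) at_top"
    using assms by (auto simp: cdf_like_def)
  have "\<forall>\<^sub>F y in at_bot. p y \<le> p x"
    using eventually_le_at_bot[of x] by eventually_elim (auto intro: monoD[OF p(1)])
  then have "0 \<le> p x" by (intro tendsto_upperbound[OF p(2)]) auto
  have "\<forall>\<^sub>F y in at_top. p x \<le> p y"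
    using eventually_ge_at_top[of x] by eventually_elim (auto intro: monoD[OF p(1)])
  then have "p x \<le> 1" by (intro tendsto_lowerbound[OF p(3)]) auto
  then show ?thesis using \<open>0 \<le> p x\<close> by simp
qed

lemma cdf_like_measurable:
  "cdf_like p \<Longrightarrow> p \<in> borel_measurable borel"
  by (simp add: cdf_like_def borel_measurable_mono)

lemma quantile_measurable:
  assumes "cdf_like p"
  shows "quantile p \<in> borel_measurable unif"
  using assms unfolding cdf_like_def
  by (intro mono_on_measurable_unif mono_onI) (auto intro: quantile_mono)

text \<open>Without right continuity the infimum in \<open>quantile\<close> need not be attained, so
  the Galois connection can fail at \<open>x = quantile p u\<close>. Any \<open>x\<close> strictly
  above the infimum lies above some \<open>y\<close> with \<open>u \<le> p y\<close>. The excluded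
  point is Lebesgue null.\<close>

lemma le_iff_quantile_le:
  assumes p: "cdf_like p" and u: "u \<in> {0<..<1}" and ne: "x \<noteq> quantile p u"
  shows "u \<le> p x \<longleftrightarrow> quantile p u \<le> x"
proof
  note p' = p[unfolded cdf_like_def, THEN conjunct1] p[unfolded cdf_like_def, THEN conjunct2, THEN conjunct1]
    p[unfolded cdf_like_def, THEN conjunct2, THEN conjunct2]
  note q = quantile_set[OF p' u]
  show "quantile p u \<le> x" if "u \<le> p x"
    unfolding quantile_def using that q by (intro cInf_lower) auto
  assume "quantile p u \<le> x"
  with ne have "Inf {x. u \<le> p x} < x" by (simp add: quantile_def)
  then obtain y where "u \<le> p y" "y < x"
    using cInf_less_iff[OF q] by auto
  then show "u \<le> p x" using monoD[OF p'(1), of y x] by simp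
qed

lemma AE_le_iff_quantile_le:
  assumes "cdf_like p" "u \<in> {0<..<1}"
  shows "AE x in lborel. u \<le> p x \<longleftrightarrow> quantile p u \<le> x"
  using AE_lborel_singleton[of "quantile p u"]
  by eventually_elim (rule le_iff_quantile_le[OF assms])

section \<open>Layer-cake formula for the excess\<close>

text \<open>Subtracting the Heaviside step makes each separate term of the potential integrable; the
  steps cancel in the sum because \<open>gen_inverse hf\<close> and \<open>gen_inverse hg\<close> have total mass 1.\<close>

definition excess :: "(real \<Rightarrow> real) \<Rightarrow> (real \<Rightarrow> real) \<Rightarrow> real \<Rightarrow> real" where
  "excess a p x = (LINT u:{0..p x}|lebesgue. a u)
     - (LINT u:{0..1}|lebesgue. a u) * indicator {0..} x"

context
  fixes a p :: "real \<Rightarrow> real"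
  assumes mono: "mono_on {0..1} a" and nonneg: "\<And>u. u \<in> {0..1} \<Longrightarrow> 0 \<le> a u" and p: "cdf_like p"
begin

lemma cumulative_measurable:
  "(\<lambda>x. LINT u:{0..p x}|lebesgue. a u) \<in> borel_measurable borel"
proof -
  have [measurable]: "a \<in> borel_measurable unif"
    by (intro mono_on_measurable_unif mono_on_subset[OF mono]) auto
  note [measurable] = cdf_like_measurable[OF p]
  have "(\<lambda>x. enn2real (\<integral>\<^sup>+u. ennreal (a u) * indicator {..p x} u \<partial>unif)) \<in> borel_measurable borel"
    by measurable
  moreover have "(LINT u:{0..p x}|lebesgue. a u) =
      enn2real (\<integral>\<^sup>+u. ennreal (a u) * indicator {..p x} u \<partial>unif)" for x
    using cumulative_weight(1,3)[OF mono nonneg cdf_like_bounds[OF p], of x] by (metis enn2real_ennreal)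
  ultimately show ?thesis by simp
qed

lemma excess_measurable [measurable]: "excess a p \<in> borel_measurable borel"
  unfolding excess_def[abs_def] using cumulative_measurable by measurable

text \<open>The excess is non-negative left of 0 and non-positive from 0 on, so its two parts live
  on separate half-lines. After Tonelli, level \<open>u\<close> contributes \<open>a u\<close> times
  the length of [\<open>quantile p u\<close>, 0) or of [0, \<open>quantile p u\<close>), that is,
  the negative or the positive part of the quantile.\<close>

lemma nn_integral_excess:
  "(\<integral>\<^sup>+x. ennreal (excess a p x) \<partial>lborel) = (\<integral>\<^sup>+u. ennreal (- (a u * quantile p u)) \<partial>unif)"
  "(\<integral>\<^sup>+x. ennreal (- excess a p x) \<partial>lborel) = (\<integral>\<^sup>+u. ennreal (a u * quantile p u) \<partial>unif)"
proof -
  have [measurable]: "a \<in> borel_measurable unif"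
    by (intro mono_on_measurable_unif mono_on_subset[OF mono]) auto
  note [measurable] = cdf_like_measurable[OF p] quantile_measurable[OF p]
  note c = cumulative_weight[OF mono nonneg cdf_like_bounds[OF p]]
  have "(\<integral>\<^sup>+x. ennreal (excess a p x) \<partial>lborel) =
      (\<integral>\<^sup>+x. (\<integral>\<^sup>+u. ennreal (a u) * indicator {..p x} u * indicator {..<0} x \<partial>unif) \<partial>lborel)"
  proof (rule nn_integral_cong)
    fix x
    show "ennreal (excess a p x) =
        (\<integral>\<^sup>+u. ennreal (a u) * indicator {..p x} u * indicator {..<0} x \<partial>unif)"
      \<comment> \<open>\<open>ennreal\<close> sends negative reals to 0, so the half-line of the
        wrong sign contributes nothing.\<close>
      using c[of x] by (cases "x < 0") (auto simp: excess_def indicator_def intro!: ennreal_neg)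
  qed
  also have "\<dots> = (\<integral>\<^sup>+u. (\<integral>\<^sup>+x. ennreal (a u) * indicator {..p x} u * indicator {..<0} x \<partial>lborel) \<partial>unif)"
    by (rule unif_lborel.Fubini') measurable
  also have "\<dots> = (\<integral>\<^sup>+u. ennreal (- (a u * quantile p u)) \<partial>unif)"
  proof (rule nn_integral_cong)
    fix u assume "u \<in> space unif"
    then have u: "u \<in> {0<..<1}" by simp
    have "(\<integral>\<^sup>+x. ennreal (a u) * indicator {..p x} u * indicator {..<0} x \<partial>lborel) =
        (\<integral>\<^sup>+x. ennreal (a u) * indicator {quantile p u..<0} x \<partial>lborel)"
      by (rule nn_integral_cong_AE) (use AE_le_iff_quantile_le[OF p u] in eventually_elim, auto simp: indicator_def)
    also have "\<dots> = ennreal (a u) * ennreal (- quantile p u)"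
      by (cases "quantile p u \<le> 0") (simp_all add: nn_integral_cmult ennreal_neg)
    also have "\<dots> = ennreal (- (a u * quantile p u))"
      using u nonneg[of u] by (simp flip: ennreal_mult')
    finally show "(\<integral>\<^sup>+x. ennreal (a u) * indicator {..p x} u * indicator {..<0} x \<partial>lborel) =
      ennreal (- (a u * quantile p u))" .
  qed
  finally show "(\<integral>\<^sup>+x. ennreal (excess a p x) \<partial>lborel) = (\<integral>\<^sup>+u. ennreal (- (a u * quantile p u)) \<partial>unif)" .
  have "(\<integral>\<^sup>+x. ennreal (- excess a p x) \<partial>lborel) =
      (\<integral>\<^sup>+x. (\<integral>\<^sup>+u. ennreal (a u) * indicator {p x<..} u * indicator {0..} x \<partial>unif) \<partial>lborel)"
  proof (rule nn_integral_cong)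
    fix x
    show "ennreal (- excess a p x) =
        (\<integral>\<^sup>+u. ennreal (a u) * indicator {p x<..} u * indicator {0..} x \<partial>unif)"
      using c[of x] by (cases "x < 0") (auto simp: excess_def indicator_def intro!: ennreal_neg)
  qed
  also have "\<dots> = (\<integral>\<^sup>+u. (\<integral>\<^sup>+x. ennreal (a u) * indicator {p x<..} u * indicator {0..} x \<partial>lborel) \<partial>unif)"
    by (rule unif_lborel.Fubini') measurable
  also have "\<dots> = (\<integral>\<^sup>+u. ennreal (a u * quantile p u) \<partial>unif)"
  proof (rule nn_integral_cong)
    fix u assume "u \<in> space unif"
    then have u: "u \<in> {0<..<1}" by simp
    have "(\<integral>\<^sup>+x. ennreal (a u) * indicator {p x<..} u * indicator {0..} x \<partial>lborel) =
        (\<integral>\<^sup>+x. ennreal (a u) * indicator {0..<quantile p u} x \<partial>lborel)"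
      by (rule nn_integral_cong_AE) (use AE_le_iff_quantile_le[OF p u] in eventually_elim, auto simp: indicator_def)
    also have "\<dots> = ennreal (a u) * ennreal (quantile p u)"
      by (cases "0 \<le> quantile p u") (simp_all add: nn_integral_cmult ennreal_neg)
    also have "\<dots> = ennreal (a u * quantile p u)"
      using u nonneg[of u] by (simp flip: ennreal_mult')
    finally show "(\<integral>\<^sup>+x. ennreal (a u) * indicator {p x<..} u * indicator {0..} x \<partial>lborel) =
      ennreal (a u * quantile p u)" .
  qed
  finally show "(\<integral>\<^sup>+x. ennreal (- excess a p x) \<partial>lborel) = (\<integral>\<^sup>+u. ennreal (a u * quantile p u) \<partial>unif)" .
qed

text \<open>Both directions are used: with \<open>a = 1\<close>, tail estimates on \<open>p\<close>
  yield an integrable quantile; with the generalized inverses, integrability passes back to the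
  excess.\<close>

lemma integrable_excess_iff:
  "integrable lborel (excess a p) \<longleftrightarrow> integrable unif (\<lambda>u. a u * quantile p u)"
proof -
  have [measurable]: "a \<in> borel_measurable unif"
    by (intro mono_on_measurable_unif mono_on_subset[OF mono]) auto
  note [measurable] = quantile_measurable[OF p]
  have "(\<lambda>u. a u * quantile p u) \<in> borel_measurable unif" by measurable
  moreover have "excess a p \<in> borel_measurable lborel" by simp
  ultimately show ?thesis unfolding real_integrable_def nn_integral_excess by auto
qed

lemma integral_excess:
  assumes "integrable unif (\<lambda>u. a u * quantile p u)"
  shows "(\<integral>x. excess a p x \<partial>lborel) = - (\<integral>u. a u * quantile p u \<partial>unif)"
  using assms integrable_excess_iff by (simp add: real_lebesgue_integral_def nn_integral_excess)

end

section \<open>The interaction term and its convexity\<close>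

text \<open>\<open>1 - g (x - z)\<close> is the measure of the levels \<open>v\<close> above it. For
  fixed \<open>v\<close>, the points \<open>x \<ge> c\<close> with \<open>g (x - z) < v\<close> form
  the interval from \<open>c\<close> to \<open>quantile g v + z\<close>, up to its right
  end.\<close>

lemma nn_integral_survival_tail:
  assumes g: "cdf_like g"
  shows "(\<integral>\<^sup>+x. indicator {c..} x * ennreal (1 - g (x - z)) \<partial>lborel) =
    (\<integral>\<^sup>+v. ennreal (quantile g v + z - c) \<partial>unif)"
proof -
  note [measurable] = cdf_like_measurable[OF g]
  have "(\<integral>\<^sup>+x. indicator {c..} x * ennreal (1 - g (x - z)) \<partial>lborel) =
      (\<integral>\<^sup>+x. (\<integral>\<^sup>+v. indicator {c..} x * indicator {g (x - z)<..} v \<partial>unif) \<partial>lborel)"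
    by (intro nn_integral_cong)
      (auto simp: nn_integral_cmult nn_integral_unif_gt[OF cdf_like_bounds[OF g]])
  also have "\<dots> = (\<integral>\<^sup>+v. (\<integral>\<^sup>+x. indicator {c..} x * indicator {g (x - z)<..} v \<partial>lborel) \<partial>unif)"
    by (rule unif_lborel.Fubini') measurable
  also have "\<dots> = (\<integral>\<^sup>+v. ennreal (quantile g v + z - c) \<partial>unif)"
  proof (rule nn_integral_cong)
    fix v assume "v \<in> space unif"
    then have v: "v \<in> {0<..<1}" by simp
    have "(\<integral>\<^sup>+x. indicator {c..} x * indicator {g (x - z)<..} v \<partial>lborel) =
        (\<integral>\<^sup>+x. indicator {c..<quantile g v + z} x \<partial>lborel)"
    proof (rule nn_integral_cong_AE)
      show "AE x in lborel. indicator {c..} x * indicator {g (x - z)<..} v =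
          (indicator {c..<quantile g v + z} x :: ennreal)"
        using AE_lborel_singleton[of "quantile g v + z"]
      proof eventually_elim
        case (elim x)
        with le_iff_quantile_le[OF g v, of "x - z"] show ?case
          by (auto simp: indicator_def)
      qed
    qed
    also have "\<dots> = ennreal (quantile g v + z - c)"
      by (cases "c \<le> quantile g v + z") (simp_all add: ennreal_neg)
    finally show "(\<integral>\<^sup>+x. indicator {c..} x * indicator {g (x - z)<..} v \<partial>lborel) =
      ennreal (quantile g v + z - c)" .
  qed
  finally show ?thesis .
qed

text \<open>Truncation by \<open>ennreal\<close> makes the innermost integrand a positive part. For
  a probability density \<open>w\<close> this is the expectation of the positive part of R + Z - Q,
  with Q, R, Z independent and Z of density \<open>w\<close>; it may be infinite when
  \<open>w\<close> decays slowly.\<close>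

definition interaction :: "(real \<Rightarrow> real) \<Rightarrow> (real \<Rightarrow> real) \<Rightarrow> (real \<Rightarrow> real) \<Rightarrow> ennreal" where
  "interaction w q r =
     (\<integral>\<^sup>+u. (\<integral>\<^sup>+z. ennreal (w z) * (\<integral>\<^sup>+v. ennreal (r v + z - q u) \<partial>unif) \<partial>lborel) \<partial>unif)"

text \<open>Tonelli twice: layering \<open>f x\<close> leaves, for each level \<open>u\<close>, an
  integral over the ray from \<open>quantile f u\<close>; exchanging \<open>x\<close> and
  \<open>z\<close> then turns the inner integral into a survival tail of \<open>g\<close>.\<close>

lemma nn_integral_interaction:
  assumes [measurable]: "w \<in> borel_measurable borel"
    and f: "cdf_like f" and g: "cdf_like g"
  shows "(\<integral>\<^sup>+x. ennreal (f x) * (\<integral>\<^sup>+z. ennreal (w z) * ennreal (1 - g (x - z)) \<partial>lborel) \<partial>lborel) =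
    interaction w (quantile f) (quantile g)"
proof -
  note [measurable] = cdf_like_measurable[OF f] cdf_like_measurable[OF g]
  define G where "G x = (\<integral>\<^sup>+z. ennreal (w z) * ennreal (1 - g (x - z)) \<partial>lborel)" for x
  have [measurable]: "G \<in> borel_measurable borel"
    unfolding G_def[abs_def] by measurable
  have "(\<integral>\<^sup>+x. ennreal (f x) * G x \<partial>lborel) =
      (\<integral>\<^sup>+x. (\<integral>\<^sup>+u. indicator {..f x} u * G x \<partial>unif) \<partial>lborel)"
    by (intro nn_integral_cong)
      (simp add: nn_integral_multc nn_integral_unif_le[OF cdf_like_bounds[OF f]])
  also have "\<dots> = (\<integral>\<^sup>+u. (\<integral>\<^sup>+x. indicator {..f x} u * G x \<partial>lborel) \<partial>unif)"
    by (rule unif_lborel.Fubini') measurable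
  also have "\<dots> = interaction w (quantile f) (quantile g)"
    unfolding interaction_def
  proof (rule nn_integral_cong)
    fix u assume "u \<in> space unif"
    then have u: "u \<in> {0<..<1}" by simp
    let ?c = "quantile f u"
    have "(\<integral>\<^sup>+x. indicator {..f x} u * G x \<partial>lborel) = (\<integral>\<^sup>+x. indicator {?c..} x * G x \<partial>lborel)"
      by (rule nn_integral_cong_AE)
        (use AE_le_iff_quantile_le[OF f u] in eventually_elim, auto simp: indicator_def)
    also have "\<dots> = (\<integral>\<^sup>+x. (\<integral>\<^sup>+z. ennreal (w z) * (indicator {?c..} x * ennreal (1 - g (x - z))) \<partial>lborel) \<partial>lborel)"
      unfolding G_def
      by (intro nn_integral_cong, subst nn_integral_cmult[symmetric]) (auto simp: ac_simps)
    also have "\<dots> = (\<integral>\<^sup>+z. (\<integral>\<^sup>+x. ennreal (w z) * (indicator {?c..} x * ennreal (1 - g (x - z))) \<partial>lborel) \<partial>lborel)"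
      by (rule lborel_pair.Fubini') measurable
    also have "\<dots> = (\<integral>\<^sup>+z. ennreal (w z) * (\<integral>\<^sup>+v. ennreal (quantile g v + z - ?c) \<partial>unif) \<partial>lborel)"
      by (subst nn_integral_cmult) (auto simp: nn_integral_survival_tail[OF g])
    finally show "(\<integral>\<^sup>+x. indicator {..f x} u * G x \<partial>lborel) =
      (\<integral>\<^sup>+z. ennreal (w z) * (\<integral>\<^sup>+v. ennreal (quantile g v + z - ?c) \<partial>unif) \<partial>lborel)" .
  qed
  finally show ?thesis by (simp add: G_def)
qed

text \<open>The positive part of an affine function of the quantile values is convex. The pointwise
  inequality is integrated within \<open>ennreal\<close>, so infinite values are covered.\<close>

lemma interaction_convex:
  assumes [measurable]: "w \<in> borel_measurable borel"
    "q0 \<in> borel_measurable unif" "q1 \<in> borel_measurable unif"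
    "r0 \<in> borel_measurable unif" "r1 \<in> borel_measurable unif"
    and t: "t \<in> {0..1}"
    and q: "\<And>u. u \<in> {0<..<1} \<Longrightarrow> q u = (1 - t) * q0 u + t * q1 u"
    and r: "\<And>u. u \<in> {0<..<1} \<Longrightarrow> r u = (1 - t) * r0 u + t * r1 u"
  shows "interaction w q r \<le> ennreal (1 - t) * interaction w q0 r0 + ennreal t * interaction w q1 r1"
proof -
  have pt: "ennreal (r v + z - q u) \<le>
      ennreal (1 - t) * ennreal (r0 v + z - q0 u) + ennreal t * ennreal (r1 v + z - q1 u)"
    if "u \<in> {0<..<1}" "v \<in> {0<..<1}" for u v z
  proof -
    \<comment> \<open>The shift splits as \<open>z = (1 - t) * z + t * z\<close> because the weights
      sum to 1.\<close>
    have "r v + z - q u = (1 - t) * (r0 v + z - q0 u) + t * (r1 v + z - q1 u)"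
      using that by (simp add: q r algebra_simps)
    also have "\<dots> \<le> (1 - t) * max 0 (r0 v + z - q0 u) + t * max 0 (r1 v + z - q1 u)"
      using t by (intro add_mono mult_left_mono) auto
    finally have "ennreal (r v + z - q u) \<le>
        ennreal ((1 - t) * max 0 (r0 v + z - q0 u) + t * max 0 (r1 v + z - q1 u))"
      by (rule ennreal_leI)
    also have "\<dots> = ennreal (1 - t) * ennreal (max 0 (r0 v + z - q0 u)) +
        ennreal t * ennreal (max 0 (r1 v + z - q1 u))"
      using t by (simp add: ennreal_plus ennreal_mult)
    finally show ?thesis by (simp add: max.commute ennreal_max_0)
  qed
  have "interaction w q r \<le>
      (\<integral>\<^sup>+u. (\<integral>\<^sup>+z. ennreal (w z) * (\<integral>\<^sup>+v. ennreal (1 - t) * ennreal (r0 v + z - q0 u)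
        + ennreal t * ennreal (r1 v + z - q1 u) \<partial>unif) \<partial>lborel) \<partial>unif)"
    unfolding interaction_def by (intro nn_integral_mono mult_left_mono) (auto intro!: pt)
  also have "\<dots> = (\<integral>\<^sup>+u. (\<integral>\<^sup>+z.
      ennreal (1 - t) * (ennreal (w z) * (\<integral>\<^sup>+v. ennreal (r0 v + z - q0 u) \<partial>unif)) +
      ennreal t * (ennreal (w z) * (\<integral>\<^sup>+v. ennreal (r1 v + z - q1 u) \<partial>unif)) \<partial>lborel) \<partial>unif)"
    by (intro nn_integral_cong) (simp add: nn_integral_add nn_integral_cmult distrib_left mult.left_commute)
  also have "\<dots> = ennreal (1 - t) * interaction w q0 r0 + ennreal t * interaction w q1 r1"
    unfolding interaction_def by (simp add: nn_integral_add nn_integral_cmult)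
  finally show ?thesis .
qed

section \<open>Extended integrals and a Borel window\<close>

text \<open>The negative part of \<open>L + K\<close> is at most that of \<open>L\<close>, hence
  finite. So no difference of infinities arises, and the sum rule survives an infinite integral of
  \<open>K\<close>.\<close>

lemma extended_integral_add_nonneg:
  fixes L K :: "real \<Rightarrow> real"
  assumes L: "integrable lborel L" and [measurable]: "K \<in> borel_measurable borel"
    and K: "\<And>x. 0 \<le> K x"
  shows "extended_integral (\<lambda>x. L x + K x) =
    ereal (\<integral>x. L x \<partial>lborel) + enn2ereal (\<integral>\<^sup>+x. ennreal (K x) \<partial>lborel)"
proof -
  have [measurable]: "L \<in> borel_measurable borel" using L by auto
  have Lneg: "(\<integral>\<^sup>+x. ennreal (- L x) \<partial>lborel) \<noteq> \<infinity>"
    using L by (simp add: real_integrable_def)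
  have "(\<integral>\<^sup>+x. ennreal (- (L x + K x)) \<partial>lborel) \<le> (\<integral>\<^sup>+x. ennreal (- L x) \<partial>lborel)"
    by (intro nn_integral_mono ennreal_leI) (simp add: K)
  with Lneg have neg: "(\<integral>\<^sup>+x. ennreal (- (L x + K x)) \<partial>lborel) \<noteq> \<infinity>"
    by (auto simp: top_unique)
  show ?thesis
  proof (cases "(\<integral>\<^sup>+x. ennreal (K x) \<partial>lborel) = \<infinity>")
    case True
    \<comment> \<open>\<open>K\<close> is bounded by the positive part of \<open>L + K\<close> plus
      the negative part of \<open>L\<close>; the latter has finite integral, so the former must
      absorb the infinity.\<close>
    have "(\<integral>\<^sup>+x. ennreal (K x) \<partial>lborel) \<le>
        (\<integral>\<^sup>+x. ennreal (L x + K x) + ennreal (- L x) \<partial>lborel)"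
    proof (intro nn_integral_mono)
      fix x
      have "ennreal (K x) \<le> ennreal (max 0 (L x + K x) + max 0 (- L x))"
        by (intro ennreal_leI) auto
      also have "\<dots> = ennreal (L x + K x) + ennreal (- L x)"
        by (simp add: ennreal_plus ennreal_max_0)
      finally show "ennreal (K x) \<le> ennreal (L x + K x) + ennreal (- L x)" .
    qed
    also have "\<dots> = (\<integral>\<^sup>+x. ennreal (L x + K x) \<partial>lborel) + (\<integral>\<^sup>+x. ennreal (- L x) \<partial>lborel)"
      by (rule nn_integral_add) auto
    finally have "(\<integral>\<^sup>+x. ennreal (L x + K x) \<partial>lborel) = \<infinity>"
      using True Lneg by (auto simp: top_unique)
    with True neg show ?thesis
      unfolding extended_integral_def nn_integral_completion
      by (cases "\<integral>\<^sup>+x. ennreal (- (L x + K x)) \<partial>lborel") (auto simp: top_ereal_def)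
  next
    case False
    have intK: "integrable lborel K"
      using False by (intro integrableI_nonneg) (auto simp: K less_top)
    note intF = Bochner_Integration.integrable_add[OF L intK]
    obtain P N where PN: "0 \<le> P" "0 \<le> N" "(\<integral>\<^sup>+x. ennreal (L x + K x) \<partial>lborel) = ennreal P"
      "(\<integral>\<^sup>+x. ennreal (- (L x + K x)) \<partial>lborel) = ennreal N"
      "(\<integral>x. L x + K x \<partial>lborel) = P - N"
      using real_integrable_def[of lborel "\<lambda>x. L x + K x"] real_lebesgue_integral_def[OF intF] intF
      by (cases "\<integral>\<^sup>+x. ennreal (L x + K x) \<partial>lborel"; cases "\<integral>\<^sup>+x. ennreal (- (L x + K x)) \<partial>lborel") auto
    have "(\<integral>\<^sup>+x. ennreal (K x) \<partial>lborel) = ennreal (\<integral>x. K x \<partial>lborel)"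
      by (rule nn_integral_eq_integral[OF intK]) (simp add: K)
    then show ?thesis
      unfolding extended_integral_def nn_integral_completion PN
      using PN Bochner_Integration.integral_add[OF L intK]
      by (simp add: enn2ereal_ennreal K)
  qed
qed

text \<open>A window is only Lebesgue measurable, whereas the Tonelli steps run over
  \<open>lborel\<close>. Changing it on a null set leaves every value of the convolution
  intact.\<close>

lemma window_borel_version:
  assumes "window w"
  obtains w' where "w' \<in> borel_measurable borel" "\<And>x. 0 \<le> w' x" "integrable lborel w'"
    "(\<integral>x. w' x \<partial>lborel) = 1"
    "\<forall>g\<in>borel_measurable borel. \<forall>x. smoothed w g x = (\<integral>z. w' z * g (x - z) \<partial>lborel)"
proof -
  have w: "integrable lebesgue w" "(LINT x|lebesgue. w x) = 1" "\<And>x. 0 \<le> w x"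
    using assms by (auto simp: window_def)
  have wm [measurable]: "w \<in> borel_measurable lebesgue" using w by auto
  obtain v where v [measurable]: "v \<in> borel_measurable borel" and ae: "AE x in lborel. w x = v x"
    using completion_ex_borel_measurable_real[OF wm] by auto
  \<comment> \<open>The maximum restores non-negativity on the null set where \<open>v\<close>
    differs from \<open>w\<close>.\<close>
  define w' where "w' x = max 0 (v x)" for x
  have m [measurable]: "w' \<in> borel_measurable borel" unfolding w'_def[abs_def] by measurable
  have ae': "AE x in lebesgue. w x = w' x"
    using AE_completion[OF ae] by eventually_elim (metis w(3) w'_def max.absorb2)
  have ml: "f \<in> borel_measurable lebesgue" if "f \<in> borel_measurable borel" for f :: "real \<Rightarrow> real"
    using that by (simp add: measurable_completion)
  have "integrable lebesgue w'"
    using w(1) ae' integrable_cong_AE[OF wm ml[OF m] ae'] by simp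
  then have "integrable lborel w'" by (simp add: integrable_completion)
  moreover have "(\<integral>x. w' x \<partial>lborel) = 1"
    using w(2) integral_cong_AE[OF wm ml[OF m] ae'] by (simp add: integral_completion)
  moreover have "smoothed w g x = (\<integral>z. w' z * g (x - z) \<partial>lborel)"
    if g [measurable]: "g \<in> borel_measurable borel" for g x
  proof -
    have gm: "(\<lambda>z. g (x - z)) \<in> borel_measurable lebesgue" by (rule ml) simp
    have "smoothed w g x = (LINT z|lebesgue. w z * g (x - z))"
      unfolding smoothed_def
      \<comment> \<open>Substitution of \<open>x - z\<close> for the integration variable.\<close>
      by (subst lebesgue_integral_real_affine[of "-1" _ x]) (simp_all)
    also have "\<dots> = (LINT z|lebesgue. w' z * g (x - z))"
      using ae' by (intro integral_cong_AE) (use gm ml[OF m] in \<open>auto\<close>)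
    also have "\<dots> = (\<integral>z. w' z * g (x - z) \<partial>lborel)"
      by (rule integral_completion) simp
    finally show ?thesis .
  qed
  ultimately show ?thesis using that[of w'] m by (auto simp: w'_def)
qed

section \<open>Generalized inverses and the normalisation\<close>

lemma gen_inverse_set:
  assumes "update_function h" "0 \<le> u"
  shows "0 \<in> {v \<in> {0..1}. h v \<le> u}" "bdd_above {v \<in> {0..1}. h v \<le> u}"
  using assms by (auto simp: update_function_def intro!: bdd_aboveI[of _ 1])

lemma gen_inverse_bounds:
  assumes "update_function h" "0 \<le> u"
  shows "gen_inverse h u \<in> {0..1}"
proof -
  note s = gen_inverse_set[OF assms]
  have "0 \<le> gen_inverse h u" unfolding gen_inverse_def by (rule cSup_upper[OF s])
  moreover have "gen_inverse h u \<le> 1" unfolding gen_inverse_def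
    by (rule cSup_least) (use s(1) in \<open>blast, simp\<close>)
  ultimately show ?thesis by simp
qed

lemma gen_inverse_mono_on:
  assumes "update_function h"
  shows "mono_on {0..1} (gen_inverse h)"
proof (rule mono_onI)
  fix u v :: real assume uv: "u \<in> {0..1}" "v \<in> {0..1}" "u \<le> v"
  have "{v' \<in> {0..1}. h v' \<le> u} \<noteq> {}"
    using gen_inverse_set(1)[OF assms, of u] uv by (metis atLeastAtMost_iff empty_iff)
  moreover have "{v' \<in> {0..1}. h v' \<le> u} \<subseteq> {v' \<in> {0..1}. h v' \<le> v}"
    using uv by auto
  ultimately show "gen_inverse h u \<le> gen_inverse h v"
    unfolding gen_inverse_def using gen_inverse_set(2)[OF assms, of v] uv
    by (intro cSup_subset_mono) auto
qed

text \<open>Dual to the quantile case: the supremum need not be attained, so the tie is excluded,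
  and strictly below the supremum monotonicity of \<open>h\<close> decides.\<close>

lemma le_gen_inverse_iff:
  assumes h: "update_function h" and u: "0 \<le> u" and v: "v \<in> {0..1}" "v \<noteq> gen_inverse h u"
  shows "v \<le> gen_inverse h u \<longleftrightarrow> h v \<le> u"
proof
  note s = gen_inverse_set[OF h u]
  show "v \<le> gen_inverse h u" if "h v \<le> u"
    unfolding gen_inverse_def using that s v by (intro cSup_upper) auto
  assume "v \<le> gen_inverse h u"
  with v have "v < Sup {v \<in> {0..1}. h v \<le> u}" by (simp add: gen_inverse_def)
  then obtain v' where "v' \<in> {0..1}" "h v' \<le> u" "v < v'"
    using less_cSup_iff[OF _ s(2)] s(1) by blast
  moreover have "h v \<le> h v'"
    using h v calculation by (auto simp: update_function_def intro: mono_onD)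
  ultimately show "h v \<le> u" by simp
qed

lemma AE_unif_neq: "AE u in unif. u \<noteq> c"
  using AE_lborel_singleton[of c] unfolding unif_def by (subst AE_restrict_space_iff) auto

interpretation unif_unif: pair_sigma_finite unif unif ..

text \<open>An area argument in the unit square: the region below the graph of the generalized
  inverse is, up to a null set, the reflection of the region above the graph of
  \<open>h\<close>.\<close>

lemma integral_gen_inverse:
  assumes h: "update_function h"
  shows "(LINT u:{0..1}|lebesgue. gen_inverse h u) = 1 - (LINT u:{0..1}|lebesgue. h u)"
proof -
  have hm: "mono_on {0..1} h" and hb: "\<And>v. v \<in> {0..1} \<Longrightarrow> h v \<in> {0..1}"
    using h by (auto simp: update_function_def)
  note gm = gen_inverse_mono_on[OF h] and gb = gen_inverse_bounds[OF h]
  have [measurable]: "h \<in> borel_measurable unif"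
    by (intro mono_on_measurable_unif mono_on_subset[OF hm]) auto
  have [measurable]: "gen_inverse h \<in> borel_measurable unif"
    by (intro mono_on_measurable_unif mono_on_subset[OF gm]) auto
  have hu: "0 \<le> h v" "h v \<le> 1" if "v \<in> space unif" for v
    using hb[of v] that by auto
  have gu: "0 \<le> gen_inverse h v" "gen_inverse h v \<le> 1" if "v \<in> space unif" for v
    using gb[of v] that by auto
  have "integrable unif h"
    by (rule unif.integrable_const_bound[where B = 1]) (use hu in \<open>auto intro!: AE_I2\<close>)
  moreover have "integrable unif (gen_inverse h)"
    by (rule unif.integrable_const_bound[where B = 1]) (use gu in \<open>auto intro!: AE_I2\<close>)
  ultimately have b: "integrable unif h" "integrable unif (\<lambda>v. 1 - h v)" "integrable unif (gen_inverse h)"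
    by auto
  have "(\<integral>\<^sup>+u. ennreal (gen_inverse h u) \<partial>unif) =
      (\<integral>\<^sup>+u. (\<integral>\<^sup>+v. indicator {..gen_inverse h u} v \<partial>unif) \<partial>unif)"
    using gb by (intro nn_integral_cong) (subst nn_integral_unif_le, auto)
  also have "\<dots> = (\<integral>\<^sup>+u. (\<integral>\<^sup>+v. indicator {h v..} u \<partial>unif) \<partial>unif)"
  proof (rule nn_integral_cong, rule nn_integral_cong_AE)
    fix u assume u: "u \<in> space unif"
    show "AE v in unif. indicator {..gen_inverse h u} v = (indicator {h v..} u :: ennreal)"
      using AE_unif_neq[of "gen_inverse h u"] AE_space
      by eventually_elim (use u le_gen_inverse_iff[OF h, of u] in \<open>auto simp: indicator_def\<close>)
  qed
  also have "\<dots> = (\<integral>\<^sup>+v. (\<integral>\<^sup>+u. indicator {h v..} u \<partial>unif) \<partial>unif)"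
    by (rule unif_unif.Fubini') measurable
  \<comment> \<open>The single level \<open>h v\<close> is null, so the ray may be taken
    open.\<close>
  also have "\<dots> = (\<integral>\<^sup>+v. (\<integral>\<^sup>+u. indicator {h v<..} u \<partial>unif) \<partial>unif)"
  proof (rule nn_integral_cong, rule nn_integral_cong_AE)
    fix v
    show "AE u in unif. indicator {h v..} u = (indicator {h v<..} u :: ennreal)"
      using AE_unif_neq[of "h v"] by eventually_elim (auto simp: indicator_def)
  qed
  also have "\<dots> = (\<integral>\<^sup>+v. ennreal (1 - h v) \<partial>unif)"
    by (intro nn_integral_cong nn_integral_unif_gt) (use hu in auto)
  finally have "(\<integral>u. gen_inverse h u \<partial>unif) = (\<integral>v. 1 - h v \<partial>unif)"
    using b hu gu
    by (subst (1 2) integral_eq_nn_integral) (auto intro!: AE_I2)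
  also have "\<dots> = 1 - (\<integral>v. h v \<partial>unif)"
    using b by (simp add: unif.prob_space[unfolded space_unif])
  moreover have "(LINT u:{0..1}|lebesgue. a u) = (\<integral>u. a u \<partial>unif)" if "mono_on {0..1} a"
    for a :: "real \<Rightarrow> real"
    by (subst LINT_Icc_eq_unif[OF that])
      (auto simp: indicator_def intro!: Bochner_Integration.integral_cong)
  ultimately show ?thesis using hm gm by simp
qed

text \<open>The gap at 1 equates the integrals of \<open>gen_inverse hg\<close> and
  \<open>hf\<close>, and the integral of \<open>gen_inverse hf\<close> is 1 minus the latter. This
  is what makes the Heaviside steps cancel in the potential.\<close>

lemma gap_normalisation:
  assumes f: "update_function hf" and g: "update_function hg" and gap: "gap hf hg 1 = 0"
  shows "(LINT u:{0..1}|lebesgue. gen_inverse hf u) + (LINT u:{0..1}|lebesgue. gen_inverse hg u) = 1"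
proof -
  have int: "set_integrable lebesgue {0..1} a" if m: "mono_on {0..1} a" and b: "\<And>u. u \<in> {0..1} \<Longrightarrow> a u \<in> {0..1}"
    for a :: "real \<Rightarrow> real"
  proof -
    have "a \<in> borel_measurable (restrict_space borel {0..1})"
      by (rule borel_measurable_mono_on_fnc) fact
    then have [measurable]: "(\<lambda>u. indicator {0..1} u * a u) \<in> borel_measurable borel"
      by (subst (asm) borel_measurable_restrict_space_iff) auto
    have "integrable lborel (\<lambda>u. indicator {0..1} u * a u)"
    proof (rule Bochner_Integration.integrable_bound)
      show "integrable lborel (\<lambda>u. indicator {0..1::real} u :: real)" by simp
      show "AE u in lborel. norm (indicator {0..1} u * a u) \<le> norm (indicator {0..1::real} u :: real)"
        using b by (auto simp: indicator_def)
    qed simp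
    then show ?thesis by (simp add: set_integrable_def integrable_completion)
  qed
  have "gap hf hg 1 = (LINT u:{0..1}|lebesgue. gen_inverse hg u) - (LINT u:{0..1}|lebesgue. hf u)"
    unfolding gap_def
    by (intro set_integral_diff int gen_inverse_mono_on g)
      (use f gen_inverse_bounds[OF g] in \<open>auto simp: update_function_def\<close>)
  with gap integral_gen_inverse[OF f] show ?thesis by simp
qed

section \<open>Integrability of profile quantiles\<close>

lemma LINT_one: "s \<in> {0..1} \<Longrightarrow> (LINT u:{0..s}|lebesgue. 1) = (s::real)"
  by (simp add: set_lebesgue_integral_def)

lemma powr_tail_integrable:
  assumes "e < - 1" "0 < (c::real)"
  shows "integrable lborel (\<lambda>x. indicator {c..} x * x powr e)"
proof (rule integrableI_nonneg)
  have "(\<integral>\<^sup>+x. ennreal (indicator {c..} x * x powr e) \<partial>lborel) = ennreal (- (c powr (e + 1)) / (e + 1))"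
    by (rule nn_integral_has_integral_lebesgue[OF _ has_integral_powr_to_inf[OF assms]]) simp
  then show "(\<integral>\<^sup>+x. ennreal (indicator {c..} x * x powr e) \<partial>lborel) < \<infinity>" by simp
qed (auto simp: indicator_def)

text \<open>For the weight 1 the excess is the profile minus the Heaviside step. The decay built
  into \<open>profiles\<close> bounds it by the power \<open>- (1 + \<epsilon>)\<close> of the
  distance to 0 in both tails, which is integrable, and integrability transfers to the
  quantile.\<close>

lemma profile_quantile_integrable:
  assumes eps: "\<epsilon> > 0" and prof: "p \<in> profiles \<epsilon>" and p: "cdf_like p"
  shows "integrable unif (quantile p)"
proof -
  let ?e = "- (1 + \<epsilon>)"
  have one: "mono_on {0..1} (\<lambda>_. 1 :: real)" by (auto intro: mono_onI)
  note pb = cdf_like_bounds[OF p]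
  have ex: "excess (\<lambda>_. 1) p x = p x - indicator {0..} x" for x
    using pb[of x] by (simp add: excess_def LINT_one)
  have "\<forall>\<^sub>F x in at_bot. \<bar>x\<bar> powr (1 + \<epsilon>) * p x < 1"
    using prof by (intro order_tendstoD(2)[where y = 0]) (auto simp: profiles_def)
  then obtain A where A: "\<And>x. x \<le> A \<Longrightarrow> \<bar>x\<bar> powr (1 + \<epsilon>) * p x < 1"
    by (auto simp: eventually_at_bot_linorder)
  have "\<forall>\<^sub>F x in at_top. - 1 < x powr (1 + \<epsilon>) * (p x - 1)"
    using prof by (intro order_tendstoD(1)[where y = 0]) (auto simp: profiles_def)
  then obtain B where B: "\<And>x. B \<le> x \<Longrightarrow> - 1 < x powr (1 + \<epsilon>) * (p x - 1)"
    by (auto simp: eventually_at_top_linorder)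
  \<comment> \<open>Beyond distance \<open>c\<close> from 0 both tail bounds hold;
    \<open>c \<ge> 1\<close> keeps the power away from its singularity at 0.\<close>
  define c where "c = max 1 (max (- A) B)"
  have c: "c > 0" "- c \<le> A" "B \<le> c" by (auto simp: c_def)
  have bd: "y \<le> x powr ?e" if "0 < x" "x powr (1 + \<epsilon>) * y < 1" for x y :: real
    using that by (simp add: powr_minus_divide pos_le_divide_eq mult.commute del: minus_add_distrib)
  define T where "T x = indicator {c..} x * x powr ?e" for x
  have T: "integrable lborel T"
    unfolding T_def using eps c by (intro powr_tail_integrable) auto
  then have T': "integrable lborel (\<lambda>x. T (- x))"
    using lborel_integrable_real_affine_iff[of "-1" T 0] by simp
  \<comment> \<open>The dominating function: one power tail on each side, and 1 on the middle
    interval, where the excess has absolute value at most 1.\<close>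
  have "integrable lborel (\<lambda>x. T x + T (- x) + indicator {- c..c} x)"
    by (intro Bochner_Integration.integrable_add T T' integrable_real_indicator) (use c in auto)
  then have "integrable lborel (excess (\<lambda>_. 1) p)"
  proof (rule Bochner_Integration.integrable_bound)
    show "excess (\<lambda>_. 1) p \<in> borel_measurable lborel"
      using excess_measurable[OF one _ p] by simp
    show "AE x in lborel. norm (excess (\<lambda>_. 1) p x) \<le> norm (T x + T (- x) + indicator {- c..c} x)"
    proof (rule AE_I2)
      fix x
      have T0: "0 \<le> T y" for y by (simp add: T_def)
      consider "x < - c" | "- c \<le> x" "x \<le> c" | "c < x" by linarith
      then show "norm (excess (\<lambda>_. 1) p x) \<le> norm (T x + T (- x) + indicator {- c..c} x)"
      proof cases
        case 1
        then have "p x \<le> (- x) powr ?e" using A[of x] c by (intro bd) auto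
        then show ?thesis using 1 c pb[of x] T0[of x] T0[of "- x"]
          by (auto simp: ex T_def)
      next
        case 2
        then show ?thesis using pb[of x] T0[of x] T0[of "- x"]
          by (auto simp: ex indicator_def)
      next
        case 3
        then have "1 - p x \<le> x powr ?e" using B[of x] c by (intro bd) (auto simp: algebra_simps)
        then show ?thesis using 3 c pb[of x] T0[of x] T0[of "- x"]
          by (auto simp: ex T_def)
      qed
    qed
  qed
  then show ?thesis using integrable_excess_iff[OF one _ p] by simp
qed

section \<open>The potential in terms of quantiles\<close>

definition linear_part ::
  "(real \<Rightarrow> real) \<Rightarrow> (real \<Rightarrow> real) \<Rightarrow> (real \<Rightarrow> real) \<Rightarrow> (real \<Rightarrow> real) \<Rightarrow> real" where
  "linear_part hf hg q r = (\<integral>u. q u \<partial>unif)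
     - (\<integral>u. gen_inverse hf u * q u \<partial>unif) - (\<integral>u. gen_inverse hg u * r u \<partial>unif)"

lemma gen_inverse_mult_integrable:
  assumes h: "update_function h" and q: "integrable unif q"
  shows "integrable unif (\<lambda>u. gen_inverse h u * q u)"
proof (rule Bochner_Integration.integrable_bound[OF q])
  have [measurable]: "gen_inverse h \<in> borel_measurable unif"
    by (intro mono_on_measurable_unif mono_on_subset[OF gen_inverse_mono_on[OF h]]) auto
  have [measurable]: "q \<in> borel_measurable unif" using q by auto
  show "(\<lambda>u. gen_inverse h u * q u) \<in> borel_measurable unif" by measurable
  show "AE u in unif. norm (gen_inverse h u * q u) \<le> norm (q u)"
  proof (rule AE_I2)
    fix u assume "u \<in> space unif"
    then have "\<bar>gen_inverse h u\<bar> \<le> 1" using gen_inverse_bounds[OF h, of u] by simp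
    then have "\<bar>gen_inverse h u\<bar> * \<bar>q u\<bar> \<le> 1 * \<bar>q u\<bar>" by (rule mult_right_mono) simp
    then show "norm (gen_inverse h u * q u) \<le> norm (q u)" by (simp add: abs_mult)
  qed
qed

text \<open>\<open>w'\<close> is the Borel representative of \<open>w\<close>, linked to it through
  \<open>sm\<close> alone. Integrable quantiles keep the linear part finite, so only the interaction
  can be infinite.\<close>

lemma potential_eq:
  assumes hf: "update_function hf" and hg: "update_function hg" and gap: "gap hf hg 1 = 0"
    and wm [measurable]: "w' \<in> borel_measurable borel" and w0: "\<And>x. 0 \<le> w' x"
    and wi: "integrable lborel w'" and w1: "(\<integral>x. w' x \<partial>lborel) = 1"
    and sm: "\<forall>g\<in>borel_measurable borel. \<forall>x. smoothed w g x = (\<integral>z. w' z * g (x - z) \<partial>lborel)"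
    and f: "cdf_like f" and fi: "integrable unif (quantile f)"
    and g: "cdf_like g" and gi: "integrable unif (quantile g)"
  shows "potential w hf hg f g = ereal (linear_part hf hg (quantile f) (quantile g)) +
    enn2ereal (interaction w' (quantile f) (quantile g))"
proof -
  note [measurable] = cdf_like_measurable[OF f] cdf_like_measurable[OF g]
  note fb = cdf_like_bounds[OF f] and gb = cdf_like_bounds[OF g]
  let ?a = "gen_inverse hf" and ?b = "gen_inverse hg"
  have one: "mono_on {0..1} (\<lambda>_. 1 :: real)" by (auto intro: mono_onI)
  have a: "mono_on {0..1} ?a" "\<And>u. u \<in> {0..1} \<Longrightarrow> 0 \<le> ?a u"
    and b: "mono_on {0..1} ?b" "\<And>u. u \<in> {0..1} \<Longrightarrow> 0 \<le> ?b u"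
    using gen_inverse_mono_on hf hg gen_inverse_bounds by auto
  note ai = gen_inverse_mult_integrable[OF hf fi] and bi = gen_inverse_mult_integrable[OF hg gi]
  define L where "L x = excess ?a f x + excess ?b g x - excess (\<lambda>_. 1) f x" for x
  define S where "S x = (\<integral>\<^sup>+z. ennreal (w' z) * ennreal (1 - g (x - z)) \<partial>lborel)" for x
  \<comment> \<open>\<open>S x\<close> is shown below to be \<open>1 - smoothed w g x\<close>, hence
    finite, so \<open>enn2real\<close> loses nothing; this form makes measurability in
    \<open>x\<close> immediate.\<close>
  define K where "K x = f x * enn2real (S x)" for x
  have e: "integrable lborel (excess ?a f)" "integrable lborel (excess ?b g)"
    "integrable lborel (excess (\<lambda>_. 1) f)"
    using integrable_excess_iff[OF a f] integrable_excess_iff[OF b g] integrable_excess_iff[OF one _ f]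
      ai bi fi by simp_all
  then have Li: "integrable lborel L" unfolding L_def[abs_def] by simp
  have "(\<integral>x. L x \<partial>lborel) = linear_part hf hg (quantile f) (quantile g)"
    unfolding L_def using e integral_excess[OF a f ai] integral_excess[OF b g bi]
      integral_excess[OF one _ f] fi by (simp add: linear_part_def)
  moreover have S: "S x = ennreal (1 - smoothed w g x)" "smoothed w g x \<le> 1" for x
  proof -
    have gi: "integrable lborel (\<lambda>z. w' z * g (x - z))"
    proof (rule Bochner_Integration.integrable_bound[OF wi])
      have "\<bar>w' z\<bar> * \<bar>g (x - z)\<bar> \<le> \<bar>w' z\<bar> * 1" for z
        using gb[of "x - z"] by (intro mult_left_mono) auto
      then show "AE z in lborel. norm (w' z * g (x - z)) \<le> norm (w' z)"
        by (simp add: abs_mult)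
    qed simp
    have i: "integrable lborel (\<lambda>z. w' z * (1 - g (x - z)))"
      using Bochner_Integration.integrable_diff[OF wi gi] by (simp add: algebra_simps)
    have nn: "0 \<le> w' z * (1 - g (x - z))" for z using w0[of z] gb[of "x - z"] by simp
    have eq: "(\<integral>z. w' z * (1 - g (x - z)) \<partial>lborel) = 1 - smoothed w g x"
      using Bochner_Integration.integral_diff[OF wi gi] by (simp add: sm w1 algebra_simps)
    have "S x = (\<integral>\<^sup>+z. ennreal (w' z * (1 - g (x - z))) \<partial>lborel)"
      unfolding S_def using w0 by (intro nn_integral_cong) (simp add: ennreal_mult')
    also have "\<dots> = ennreal (1 - smoothed w g x)"
      using nn_integral_eq_integral[OF i] nn eq by simp
    finally show "S x = ennreal (1 - smoothed w g x)" .
    have "0 \<le> (\<integral>z. w' z * (1 - g (x - z)) \<partial>lborel)"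
      by (rule Bochner_Integration.integral_nonneg) (rule nn)
    then show "smoothed w g x \<le> 1" using eq by simp
  qed
  moreover have [measurable]: "S \<in> borel_measurable borel"
    unfolding S_def[abs_def] by measurable
  have "K \<in> borel_measurable borel" unfolding K_def[abs_def] by measurable
  moreover have "0 \<le> K x" for x using fb[of x] by (simp add: K_def)
  moreover have "(\<integral>\<^sup>+x. ennreal (K x) \<partial>lborel) = interaction w' (quantile f) (quantile g)"
    unfolding nn_integral_interaction[OF wm f g, symmetric] K_def S_def[symmetric]
    using fb by (intro nn_integral_cong) (auto simp: ennreal_mult S)
  \<comment> \<open>The steps in \<open>L\<close> carry total weight 0 by the normalisation, and the
    \<open>- f x\<close> from the weight-1 excess is restored by \<open>K\<close>. The case split
    evaluates the step at \<open>x\<close>.\<close>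
  moreover have "(LINT u:{0..g x}|lebesgue. ?b u) + (LINT v:{0..f x}|lebesgue. ?a v)
      - f x * smoothed w g x = L x + K x" for x
    using fb[of x] S(2)[of x] gap_normalisation[OF hf hg gap]
    by (cases "0 \<le> x") (auto simp: L_def K_def S excess_def LINT_one algebra_simps)
  ultimately show ?thesis
    unfolding potential_def using extended_integral_add_nonneg[OF Li, of K] by simp
qed

section \<open>Convexity along the displacement interpolation\<close>

lemma linear_part_affine:
  assumes hf: "update_function hf" and hg: "update_function hg"
    and i: "integrable unif q0" "integrable unif q1" "integrable unif r0" "integrable unif r1"
    and q: "\<And>u. u \<in> {0<..<1} \<Longrightarrow> q u = (1 - t) * q0 u + t * q1 u"
    and r: "\<And>u. u \<in> {0<..<1} \<Longrightarrow> r u = (1 - t) * r0 u + t * r1 u"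
  shows "linear_part hf hg q r = (1 - t) * linear_part hf hg q0 r0 + t * linear_part hf hg q1 r1"
proof -
  note m = gen_inverse_mult_integrable[OF hf] gen_inverse_mult_integrable[OF hg]
  have "(\<integral>u. q u \<partial>unif) = (\<integral>u. (1 - t) * q0 u + t * q1 u \<partial>unif)"
    by (intro Bochner_Integration.integral_cong) (auto simp: q)
  moreover have "(\<integral>u. gen_inverse hf u * q u \<partial>unif) =
      (\<integral>u. (1 - t) * (gen_inverse hf u * q0 u) + t * (gen_inverse hf u * q1 u) \<partial>unif)"
    by (intro Bochner_Integration.integral_cong) (auto simp: q algebra_simps)
  moreover have "(\<integral>u. gen_inverse hg u * r u \<partial>unif) =
      (\<integral>u. (1 - t) * (gen_inverse hg u * r0 u) + t * (gen_inverse hg u * r1 u) \<partial>unif)"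
    by (intro Bochner_Integration.integral_cong) (auto simp: r algebra_simps)
  ultimately show ?thesis
    using i m by (simp add: linear_part_def) (simp add: algebra_simps)
qed

text \<open>Integrability is inherited from the two endpoint quantiles through the affine formula,
  rather than from tail decay of the interpolant.\<close>

lemma displacement_interpolant_quantile:
  assumes "\<epsilon> > 0" "p0 \<in> profiles \<epsilon>" "p1 \<in> profiles \<epsilon>" "mono p0" "mono p1" "t \<in> {0..1}"
  defines "p \<equiv> displacement_interpolant p0 p1 t"
  shows "cdf_like p" "integrable unif (quantile p)"
    "\<And>u. u \<in> {0<..<1} \<Longrightarrow> quantile p u = (1 - t) * quantile p0 u + t * quantile p1 u"
proof -
  have d: "is_displacement_interpolant p0 p1 t p"
    unfolding p_def using assms by (intro is_displacement_interpolant_displacement_interpolant)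
  then show q: "\<And>u. u \<in> {0<..<1} \<Longrightarrow> quantile p u = (1 - t) * quantile p0 u + t * quantile p1 u"
    by (simp add: is_displacement_interpolant_def)
  obtain M where M: "real_distribution M" "p = cdf M"
    using d by (auto simp: is_displacement_interpolant_def)
  interpret real_distribution M by fact
  show "cdf_like p"
    unfolding cdf_like_def M(2)
    by (auto intro!: monoI cdf_nondecreasing cdf_lim_at_bot cdf_lim_at_top_prob)
  have "integrable unif (quantile p0)" "integrable unif (quantile p1)"
    using assms profiles_limits by (auto intro!: profile_quantile_integrable simp: cdf_like_def)
  then have "integrable unif (\<lambda>u. (1 - t) * quantile p0 u + t * quantile p1 u)" by simp
  then show "integrable unif (quantile p)"
    by (rule Bochner_Integration.integrable_cong[THEN iffD1, rotated -1]) (auto simp: q)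
qed

lemma ereal_convex_combination_le:
  assumes t: "t \<in> {0..1}" and K: "K \<le> ennreal (1 - t) * K0 + ennreal t * K1"
  shows "ereal ((1 - t) * c0 + t * c1) + enn2ereal K \<le>
    ereal (1 - t) * (ereal c0 + enn2ereal K0) + ereal t * (ereal c1 + enn2ereal K1)"
proof -
  \<comment> \<open>Distributivity is legitimate because \<open>c\<close> and \<open>a\<close> are
    finite; for \<open>c = 0\<close> and infinite \<open>J\<close> it rests on
    \<open>0 * \<infinity> = 0\<close>.\<close>
  have d: "ereal c * (ereal a + enn2ereal J) = ereal (c * a) + ereal c * enn2ereal J" for a c J
    using ereal_distrib_left[of "ereal a" "enn2ereal J" "ereal c"] by auto
  have "enn2ereal K \<le> enn2ereal (ennreal (1 - t) * K0 + ennreal t * K1)"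
    using K by (simp add: less_eq_ennreal.rep_eq)
  also have "\<dots> = ereal (1 - t) * enn2ereal K0 + ereal t * enn2ereal K1"
    using t by (simp add: plus_ennreal.rep_eq times_ennreal.rep_eq enn2ereal_ennreal)
  finally have "ereal ((1 - t) * c0 + t * c1) + enn2ereal K \<le>
      ereal ((1 - t) * c0 + t * c1) + (ereal (1 - t) * enn2ereal K0 + ereal t * enn2ereal K1)"
    by (rule add_left_mono)
  also have "\<dots> = ereal (1 - t) * (ereal c0 + enn2ereal K0) + ereal t * (ereal c1 + enn2ereal K1)"
    unfolding d plus_ereal.simps(1)[symmetric] by (simp only: ac_simps)
  finally show ?thesis .
qed

theorem mainTheorem2:
  fixes w hf hg f0 f1 g0 g1 :: "real \<Rightarrow> real" and \<epsilon> :: real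
  assumes "window w"
    and "update_function hf" and "update_function hg"
    and "strictly_positive_gap hf hg"
    and "\<epsilon> > 0"
    and "f0 \<in> profiles \<epsilon>" and "f1 \<in> profiles \<epsilon>"
    and "g0 \<in> profiles \<epsilon>" and "g1 \<in> profiles \<epsilon>"
    and "mono f0" and "mono f1" and "mono g0" and "mono g1"
  shows "\<forall>t\<in>{0..1}.
    potential w hf hg (displacement_interpolant f0 f1 t) (displacement_interpolant g0 g1 t)
      \<le> ereal (1 - t) * potential w hf hg f0 g0 + ereal t * potential w hf hg f1 g1"
proof
  fix t :: real assume t: "t \<in> {0..1}"
  obtain w' where w': "w' \<in> borel_measurable borel" "\<And>x. 0 \<le> w' x" "integrable lborel w'"
    "(\<integral>x. w' x \<partial>lborel) = 1"
    "\<forall>g\<in>borel_measurable borel. \<forall>x. smoothed w g x = (\<integral>z. w' z * g (x - z) \<partial>lborel)"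
    using window_borel_version[OF assms(1)] by blast
  have gap: "gap hf hg 1 = 0" using assms(4) by (simp add: strictly_positive_gap_def)
  note pot = potential_eq[OF assms(2,3) gap w']
  have c: "cdf_like f0" "cdf_like f1" "cdf_like g0" "cdf_like g1"
    using assms profiles_limits by (auto simp: cdf_like_def)
  have i: "integrable unif (quantile f0)" "integrable unif (quantile f1)"
    "integrable unif (quantile g0)" "integrable unif (quantile g1)"
    using c assms(6-9) by (auto intro: profile_quantile_integrable[OF assms(5)])
  let ?f = "displacement_interpolant f0 f1 t" and ?g = "displacement_interpolant g0 g1 t"
  note F = displacement_interpolant_quantile[OF assms(5,6,7,10,11) t]
  note G = displacement_interpolant_quantile[OF assms(5,8,9,12,13) t]
  have K: "interaction w' (quantile ?f) (quantile ?g) \<le>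
      ennreal (1 - t) * interaction w' (quantile f0) (quantile g0) +
      ennreal t * interaction w' (quantile f1) (quantile g1)"
    by (rule interaction_convex[OF w'(1) quantile_measurable[OF c(1)] quantile_measurable[OF c(2)]
          quantile_measurable[OF c(3)] quantile_measurable[OF c(4)] t])
      (rule F(3), assumption, rule G(3), assumption)
  have lin: "linear_part hf hg (quantile ?f) (quantile ?g) =
      (1 - t) * linear_part hf hg (quantile f0) (quantile g0) +
      t * linear_part hf hg (quantile f1) (quantile g1)"
    by (rule linear_part_affine[OF assms(2,3) i]) (rule F(3), assumption, rule G(3), assumption)
  show "potential w hf hg ?f ?g
      \<le> ereal (1 - t) * potential w hf hg f0 g0 + ereal t * potential w hf hg f1 g1"
    \<comment> \<open>All three potentials become a linear part plus an interaction. The linear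
      parts balance exactly, so the inequality comes from the interaction alone.\<close>
    unfolding pot[OF c(1) i(1) c(3) i(3)] pot[OF c(2) i(2) c(4) i(4)] pot[OF F(1,2) G(1,2)] lin
    by (rule ereal_convex_combination_le[OF t K])
qed

end
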